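(* Let $N\ge 1$. Consider the following map $\Phi$ from multi-edge trees with $N$ edges (counting multiplicities) to 3-coloured Motzkin paths of length $N-1$. Given a multi-edge tree whose underlying ordered tree has $n$ edges, with multiplicities $a_1,\dots,a_n\ge 1$ listed in pre-order, $a_1+\dots+a_n=N$: 1. Ignoring the multiplicities, translate the ordered tree into the Dyck path of length $2n$ by the standard walk around the tree. 2. Delete the first up-step and the last down-step of this Dyck path, group the remaining $2n-2$ steps into consecutive pairs, and replace each pair as follows: up-up by an up-step, down-down by a down-step, up-down by a red horizontal step, down-up by a green horizontal step. This gives a 2-coloured Motzkin path of length $n-1$. 3. There are $n$ positions in this path (at the beginning, between consecutive steps, and at the end), taken from left to right; for each $i=1,\dots,n$ insert $a_i-1$ blue horizontal steps at the $i$-th position. Then $\Phi$ is a bijection from the set of multi-edge trees with $N$ edges (counting multiplicities) to the set of 3-coloured Motzkin paths of length $N-1$.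
   Context: A multi-edge tree is an ordered (plane rooted) tree in which every edge carries a label, its multiplicity, which is an integer $\ge 1$ (thought of as that many parallel edges); its number of edges counting multiplicities is the sum of the labels. A Motzkin path of length $m$ consists of $m$ steps, each an up-step $(1,1)$, a down-step $(1,-1)$ or a horizontal step $(1,0)$, starts at the origin, ends on the $x$-axis, and never goes below the $x$-axis. A 2-coloured (3-coloured) Motzkin path is a Motzkin path in which each horizontal step has one of the colours red, green (respectively red, green, blue). A Dyck path is a Motzkin path without horizontal steps. The standard walk around an ordered tree traverses the tree in depth-first order from left to right starting at the root, recording an up-step whenever an edge is traversed away from the root and a down-step whenever an edge is traversed towards the root. The pre-order of edges is the order in which they are first traversed in this walk. *)

theory Defs
  imports Main
begin

section \<open>Lattice paths\<close>

datatype colour = Red | Green | Blue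

datatype step = Up | Down | Horizontal colour

fun rise :: "step \<Rightarrow> int" where
  "rise Up = 1"
| "rise Down = -1"
| "rise (Horizontal c) = 0"

definition height :: "step list \<Rightarrow> int" where
  "height p = sum_list (map rise p)"

text \<open>As all three colours are allowed, this is the notion of a 3-coloured Motzkin path.\<close>

definition motzkin_path :: "step list \<Rightarrow> bool" where
  "motzkin_path p \<longleftrightarrow> height p = 0 \<and> (\<forall>k \<le> length p. height (take k p) \<ge> 0)"

section \<open>Ordered trees with labelled edges\<close>

text \<open>A vertex is given by the list, from left to right, of its outgoing edges; each edge
  consists of its label and the subtree hanging from it.\<close>

datatype 'a edge_tree = Node "('a \<times> 'a edge_tree) list"

text \<open>The standard walk, with each step recorded together with the label of the edge
  traversed.\<close>

fun labelled_walk :: "'a edge_tree \<Rightarrow> (step \<times> 'a) list" where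
  "labelled_walk (Node es) =
     concat (map (\<lambda>(a, t). (Up, a) # labelled_walk t @ [(Down, a)]) es)"

definition walk :: "'a edge_tree \<Rightarrow> step list" where
  "walk t = map fst (labelled_walk t)"

definition preorder_labels :: "'a edge_tree \<Rightarrow> 'a list" where
  "preorder_labels t = map snd (filter (\<lambda>(s, a). s = Up) (labelled_walk t))"

definition multi_edge_tree :: "nat edge_tree \<Rightarrow> bool" where
  "multi_edge_tree t \<longleftrightarrow> (\<forall>a \<in> set (preorder_labels t). a \<ge> 1)"

definition num_edges :: "nat edge_tree \<Rightarrow> nat" where
  "num_edges t = sum_list (preorder_labels t)"

section \<open>The map\<close>

text \<open>Only pairs of up- and down-steps are relevant; other pairs are left unspecified.\<close>

fun merge :: "step \<Rightarrow> step \<Rightarrow> step" where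
  "merge Up Up = Up"
| "merge Down Down = Down"
| "merge Up Down = Horizontal Red"
| "merge Down Up = Horizontal Green"

text \<open>Only lists of even length are relevant.\<close>

fun merge_pairs :: "step list \<Rightarrow> step list" where
  "merge_pairs (x # y # p) = merge x y # merge_pairs p"
| "merge_pairs _ = []"

text \<open>Only the case where the first list is longer than the second one by exactly one
  is relevant.\<close>

fun insert_blue :: "nat list \<Rightarrow> step list \<Rightarrow> step list" where
  "insert_blue (a # as) (s # p) = replicate (a - 1) (Horizontal Blue) @ s # insert_blue as p"
| "insert_blue (a # as) [] = replicate (a - 1) (Horizontal Blue)"
| "insert_blue [] p = p"

definition Phi :: "nat edge_tree \<Rightarrow> step list" where
  "Phi t = insert_blue (preorder_labels t) (merge_pairs (butlast (tl (walk t))))"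

end

theory Submission
  imports Defs
begin

text \<open>The map is a composition of three bijections. The data carried between them is a path
  together with a list of positive labels summing to \<open>N\<close>.

  \<^item> The standard walk and the pre-order labels determine the tree: the pair is parsed back
    from left to right, a subtree ending exactly where the walk is exhausted or continues
    with a down-step (\<open>parse_unique\<close>, \<open>parse_exists\<close>). The pairs that occur are the Dyck paths
    with one label for each up-step.
  \<^item> Without its first and last step, a non-empty Dyck path starts and ends at height 1. Read
    in pairs, it visits the odd heights \<open>2 * h + 1\<close>, where \<open>h\<close> is the height of the merged
    path. The intermediate points are at even heights, hence non-negative as soon as their
    odd neighbours are. So merging preserves and reflects the property of being a Motzkin
    path, with no condition on where a green step may occur (\<open>leads_merge_pairs\<close>).
  \<^item> Blue steps do not change the height. A 3-coloured path is therefore given by the path of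
    its other steps, together with the lengths of the possibly empty blocks of blue steps
    before, between and after them; these lengths are the labels minus 1 (\<open>bij_insert_blue\<close>).\<close>

section \<open>Paths between given heights\<close>

text \<open>Motzkin paths with free initial and final heights. The heights must vary in an induction
  along the path, and cutting a path into pieces leaves pieces between arbitrary heights.\<close>

fun leads :: "int \<Rightarrow> step list \<Rightarrow> int \<Rightarrow> bool" where
  "leads h [] k \<longleftrightarrow> 0 \<le> h \<and> h = k"
| "leads h (s # p) k \<longleftrightarrow> 0 \<le> h \<and> leads (h + rise s) p k"

lemma leads_nonneg: "leads h p k \<Longrightarrow> 0 \<le> h"
  by (cases p) auto

lemma leads_iff_height:
  "leads h p k \<longleftrightarrow> h + height p = k \<and> (\<forall>i \<le> length p. 0 \<le> h + height (take i p))"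
proof (induction p arbitrary: h)
  case Nil
  then show ?case by (auto simp: height_def)
next
  case (Cons s p)
  have "(\<forall>i \<le> length (s # p). 0 \<le> h + height (take i (s # p))) \<longleftrightarrow>
      0 \<le> h \<and> (\<forall>i \<le> length p. 0 \<le> h + rise s + height (take i p))"
    by (simp add: All_less_Suc2 height_def add.assoc flip: less_Suc_eq_le)
  then show ?case
    using Cons.IH by (auto simp: height_def)
qed

corollary motzkin_path_iff_leads: "motzkin_path p \<longleftrightarrow> leads 0 p 0"
  by (simp add: motzkin_path_def leads_iff_height)

lemma leads_append: "leads h (p @ q) k \<longleftrightarrow> (\<exists>m. leads h p m \<and> leads m q k)"
  by (induction p arbitrary: h) (auto dest: leads_nonneg)

lemma leads_count_Up:
  assumes "leads h p k" "set p \<subseteq> {Up, Down}"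
  shows "h + 2 * int (count_list p Up) = k + int (length p)"
  using assms by (induction p arbitrary: h) fastforce+

section \<open>Trees as Dyck paths with labels\<close>

lemma walk_Nil [simp]: "walk (Node []) = []"
  by (simp add: walk_def)

lemma walk_Cons [simp]: "walk (Node ((a, t) # es)) = Up # walk t @ Down # walk (Node es)"
  by (simp add: walk_def)

lemma labels_Nil [simp]: "preorder_labels (Node []) = []"
  by (simp add: preorder_labels_def)

lemma labels_Cons [simp]:
  "preorder_labels (Node ((a, t) # es)) = a # preorder_labels t @ preorder_labels (Node es)"
  by (simp add: preorder_labels_def)

text \<open>Induction one edge at a time, because parsing a walk meets the edges one at a time: it
  enters the leftmost subtree and then continues with the remaining edges of the vertex.\<close>

lemma edge_tree_induct [case_names Leaf Attach]:
  assumes "P (Node [])"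
    and "\<And>a t es. P t \<Longrightarrow> P (Node es) \<Longrightarrow> P (Node ((a, t) # es))"
  shows "P t"
proof (induction t)
  case (Node es)
  then show ?case
    by (induction es) (use assms in \<open>fastforce+\<close>)
qed

lemma set_walk: "set (walk t) \<subseteq> {Up, Down}"
  by (induction t rule: edge_tree_induct) auto

lemma length_preorder_labels: "length (preorder_labels t) = count_list (walk t) Up"
  by (induction t rule: edge_tree_induct) auto

lemma leads_walk_append [simp]: "leads h (walk t @ r) k \<longleftrightarrow> leads h r k"
  by (induction t arbitrary: h r rule: edge_tree_induct) (auto dest: leads_nonneg)

corollary motzkin_path_walk: "motzkin_path (walk t)"
  using leads_walk_append[of 0 t "[]" 0] by (simp add: motzkin_path_iff_leads)

text \<open>The remainders \<open>r\<close>, \<open>l\<close> make the induction work: after a subtree, the walk returns along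
  its edge by a down-step. Any further edge inside the subtree would begin with an up-step, so
  this down-step marks where the subtree ends.\<close>

lemma parse_unique:
  assumes "walk t @ r = walk t' @ r'"
    and "preorder_labels t @ l = preorder_labels t' @ l'"
    and "r = [] \<or> hd r = Down" "r' = [] \<or> hd r' = Down"
  shows "t = t' \<and> r = r' \<and> l = l'"
  using assms
proof (induction t arbitrary: t' r r' l l' rule: edge_tree_induct)
  case Leaf
  obtain es' where t': "t' = Node es'" by (cases t')
  show ?case
    using Leaf unfolding t' by (cases es') auto
next
  case (Attach a t es)
  obtain es' where t': "t' = Node es'" by (cases t')
  have "es' \<noteq> []"
    using Attach.prems unfolding t' by auto
  then obtain b u fs where es': "es' = (b, u) # fs"
    by (cases es') auto
  have "a = b"
    and w: "walk t @ (Down # walk (Node es) @ r) = walk u @ (Down # walk (Node fs) @ r')"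
    and l: "preorder_labels t @ (preorder_labels (Node es) @ l) =
      preorder_labels u @ (preorder_labels (Node fs) @ l')"
    using Attach.prems unfolding t' es' by auto
  have "t = u" and w': "walk (Node es) @ r = walk (Node fs) @ r'"
    and l': "preorder_labels (Node es) @ l = preorder_labels (Node fs) @ l'"
    using Attach.IH(1)[OF w l] by auto
  from Attach.IH(2)[OF w' l' Attach.prems(3,4)] show ?case
    using \<open>a = b\<close> \<open>t = u\<close> by (simp add: t' es')
qed

text \<open>A path leading down to 0 has a matching down-step for each of its up-steps, so each
  subtree that is entered is also left.\<close>

lemma parse_exists:
  assumes "leads h p 0" "set p \<subseteq> {Up, Down}" "length l = count_list p Up"
  shows "\<exists>t r l'. p = walk t @ r \<and> l = preorder_labels t @ l' \<and>
    (r = [] \<or> hd r = Down)"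
  using assms
proof (induction "length p" arbitrary: h p l rule: less_induct)
  case less
  show ?case
  proof (cases "p = [] \<or> hd p = Down")
    case True
    then have "p = walk (Node []) @ p \<and> l = preorder_labels (Node []) @ l \<and> (p = [] \<or> hd p = Down)"
      by simp
    then show ?thesis by blast
  next
    case False
    then obtain q where p: "p = Up # q"
      using less.prems(2) by (cases p) auto
    then obtain a m where l: "l = a # m"
      using less.prems(3) by (cases l) auto
    have q: "leads (h + 1) q 0" "set q \<subseteq> {Up, Down}" "length m = count_list q Up" and "0 \<le> h"
      using less.prems by (auto simp: p l)
    obtain t r m' where t: "q = walk t @ r" "m = preorder_labels t @ m'" "r = [] \<or> hd r = Down"
      using less.hyps[OF _ q] p by auto
    have r: "leads (h + 1) r 0"
      using q(1) by (simp add: t(1))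
    then obtain q' where r': "r = Down # q'"
      using t(3) \<open>0 \<le> h\<close> by (cases r) auto
    have q': "leads h q' 0" "set q' \<subseteq> {Up, Down}" "length m' = count_list q' Up"
      using r q t length_preorder_labels[of t] by (auto simp: r')
    obtain u r'' m'' where
      u: "q' = walk u @ r''" "m' = preorder_labels u @ m''" "r'' = [] \<or> hd r'' = Down"
      using less.hyps[OF _ q'] p t(1) r' by auto
    obtain es where "u = Node es" by (cases u)
    then have "p = walk (Node ((a, t) # es)) @ r'' \<and>
        l = preorder_labels (Node ((a, t) # es)) @ m'' \<and> (r'' = [] \<or> hd r'' = Down)"
      using u by (simp add: p l t(1,2) r')
    then show ?thesis by blast
  qed
qed

definition labelled_dyck_paths :: "(step list \<times> 'a list) set" where
  "labelled_dyck_paths =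
     {(d, as). motzkin_path d \<and> set d \<subseteq> {Up, Down} \<and> length as = count_list d Up}"

lemma bij_walk: "bij_betw (\<lambda>t. (walk t, preorder_labels t)) UNIV labelled_dyck_paths"
  unfolding bij_betw_def
proof (intro conjI subset_antisym)
  show "inj (\<lambda>t. (walk t, preorder_labels t))"
    by (rule injI) (use parse_unique[of _ "[]" _ "[]" "[]" "[]"] in auto)
  show "range (\<lambda>t. (walk t, preorder_labels t)) \<subseteq> labelled_dyck_paths"
    using set_walk by (auto simp: labelled_dyck_paths_def motzkin_path_walk length_preorder_labels)
  show "labelled_dyck_paths \<subseteq> range (\<lambda>t. (walk t, preorder_labels t :: 'a list))"
  proof (rule subrelI)
    fix d and as :: "'a list"
    assume "(d, as) \<in> labelled_dyck_paths"
    then have d: "leads 0 d 0" "set d \<subseteq> {Up, Down}" "length as = count_list d Up"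
      by (auto simp: labelled_dyck_paths_def motzkin_path_iff_leads)
    obtain t r l where t: "d = walk t @ r" "as = preorder_labels t @ l" "r = [] \<or> hd r = Down"
      using parse_exists[OF d] by blast
    have "leads 0 r 0"
      using d(1) by (simp add: t(1))
    \<comment> \<open>A remaining down-step would start at height 0.\<close>
    then have "r = []"
      using t(3) by (cases r) (auto dest: leads_nonneg)
    moreover from this have "l = []"
      using d(3) length_preorder_labels[of t] by (simp add: t(1,2))
    ultimately show "(d, as) \<in> range (\<lambda>t. (walk t, preorder_labels t))"
      by (simp add: t(1,2))
  qed
qed

section \<open>Merging pairs of steps\<close>

fun split_step :: "step \<Rightarrow> step list" where
  "split_step Up = [Up, Up]"
| "split_step Down = [Down, Down]"
| "split_step (Horizontal c) = (if c = Red then [Up, Down] else [Down, Up])"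

definition split_steps :: "step list \<Rightarrow> step list" where
  "split_steps q = concat (map split_step q)"

lemma length_split_steps [simp]: "length (split_steps q) = 2 * length q"
proof -
  have "length (split_step s) = 2" for s
    by (cases s) auto
  then show ?thesis
    by (induction q) (auto simp: split_steps_def)
qed

lemma set_split_steps: "set (split_steps q) \<subseteq> {Up, Down}"
proof -
  have "set (split_step s) \<subseteq> {Up, Down}" for s
    by (cases s) auto
  then show ?thesis
    by (auto simp: split_steps_def)
qed

lemma merge_split_steps: "Horizontal Blue \<notin> set q \<Longrightarrow> merge_pairs (split_steps q) = q"
proof (induction q)
  case Nil
  then show ?case by (simp add: split_steps_def)
next
  case (Cons s q)
  then have "s = Up \<or> s = Down \<or> s = Horizontal Red \<or> s = Horizontal Green"
    by (metis colour.exhaust step.exhaust list.set_intros(1))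
  then show ?case
    using Cons by (auto simp: split_steps_def)
qed

lemma split_merge_pairs:
  "even (length p) \<Longrightarrow> set p \<subseteq> {Up, Down} \<Longrightarrow> split_steps (merge_pairs p) = p"
  by (induction p rule: merge_pairs.induct) (auto simp: split_steps_def)

lemma length_merge_pairs: "length (merge_pairs p) = length p div 2"
  by (induction p rule: merge_pairs.induct) auto

lemma Blue_notin_merge_pairs: "set p \<subseteq> {Up, Down} \<Longrightarrow> Horizontal Blue \<notin> set (merge_pairs p)"
  by (induction p rule: merge_pairs.induct) auto

text \<open>Height \<open>h\<close> of the merged path corresponds to height \<open>2 * h + 1\<close> of the original one. The
  point inside a pair is at height \<open>2 * h\<close> or \<open>2 * h + 2\<close>, so it imposes no further
  condition. The offset 1 is the effect of the deleted first up-step.\<close>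

lemma leads_merge_pairs:
  assumes "even (length p)" "set p \<subseteq> {Up, Down}"
  shows "leads (2 * h + 1) (p @ [Down]) 0 \<longleftrightarrow> leads h (merge_pairs p) 0"
  using assms
proof (induction p arbitrary: h rule: merge_pairs.induct)
  case (1 x y p)
  have IH: "leads (2 * k + 1) (p @ [Down]) 0 \<longleftrightarrow> leads k (merge_pairs p) 0" for k
    using 1 by simp
  consider "x = Up" "y = Up" | "x = Up" "y = Down" | "x = Down" "y = Up" | "x = Down" "y = Down"
    using "1.prems" by auto
  then show ?case
  proof cases
    case 1
    then show ?thesis
      using IH[of "h + 1"] by (auto simp: algebra_simps)
  next
    case 2
    then show ?thesis
      using IH[of h] by (auto simp: algebra_simps)
  next
    case 3
    then show ?thesis
      using IH[of h] by (auto simp: algebra_simps dest: leads_nonneg)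
  next
    case 4
    then show ?thesis
      using IH[of "h - 1"] by (auto simp: algebra_simps)
  qed
qed auto

corollary motzkin_path_merge_pairs:
  assumes "even (length p)" "set p \<subseteq> {Up, Down}"
  shows "motzkin_path (Up # p @ [Down]) \<longleftrightarrow> motzkin_path (merge_pairs p)"
  using leads_merge_pairs[OF assms, of 0] by (simp add: motzkin_path_iff_leads)

lemma dyck_path_cases:
  assumes "motzkin_path d" "set d \<subseteq> {Up, Down}" "d \<noteq> []"
  obtains p where "d = Up # p @ [Down]" "set p \<subseteq> {Up, Down}" "length p = 2 * (count_list d Up - 1)"
proof -
  have d: "leads 0 d 0"
    using assms(1) by (simp add: motzkin_path_iff_leads)
  obtain q where q: "d = Up # q"
    using d assms(2,3) by (cases d) (auto dest: leads_nonneg)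
  then have "q \<noteq> []"
    using d by auto
  then obtain p s where p: "d = Up # p @ [s]"
    using q by (metis rev_exhaust)
  moreover have "s = Down"
    using d assms(2) by (auto simp: p leads_append)
  moreover have "length p = 2 * (count_list d Up - 1)"
    using leads_count_Up[OF d assms(2)] by (simp add: p)
  ultimately show thesis
    using that assms(2) by auto
qed

definition labelled_blue_free_paths :: "(step list \<times> 'a list) set" where
  "labelled_blue_free_paths =
     {(q, as). motzkin_path q \<and> Horizontal Blue \<notin> set q \<and> length as = Suc (length q)}"

lemma bij_merge_pairs:
  "bij_betw (\<lambda>(d, as). (merge_pairs (butlast (tl d)), as))
     {(d, as) \<in> labelled_dyck_paths. as \<noteq> []} labelled_blue_free_paths"
proof (rule bij_betw_byWitness[where f' = "\<lambda>(q, as). (Up # split_steps q @ [Down], as)"])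
  have ex: "\<exists>p. d = Up # p @ [Down] \<and> set p \<subseteq> {Up, Down} \<and> length p = 2 * (length as - 1)"
    if "(d, as) \<in> labelled_dyck_paths" "as \<noteq> []" for d and as :: "'a list"
  proof -
    have "d \<noteq> []"
      using that by (auto simp: labelled_dyck_paths_def)
    then show ?thesis
      using that dyck_path_cases[of d] unfolding labelled_dyck_paths_def by fastforce
  qed
  show "\<forall>x\<in>{(d, as) \<in> labelled_dyck_paths. as \<noteq> []}.
      (case (case x of (d, as) \<Rightarrow> (merge_pairs (butlast (tl d)), as)) of
        (q, as) \<Rightarrow> (Up # split_steps q @ [Down], as)) = (x :: step list \<times> 'a list)"
    using ex by (fastforce simp: split_merge_pairs)
  show "\<forall>x\<in>labelled_blue_free_paths.
      (case (case x of (q, as) \<Rightarrow> (Up # split_steps q @ [Down], as)) of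
        (d, as) \<Rightarrow> (merge_pairs (butlast (tl d)), as)) = (x :: step list \<times> 'a list)"
    by (auto simp: labelled_blue_free_paths_def merge_split_steps)
  show "(\<lambda>(d, as). (merge_pairs (butlast (tl d)), as)) `
      {(d, as) \<in> labelled_dyck_paths. as \<noteq> []} \<subseteq> (labelled_blue_free_paths :: (_ \<times> 'a list) set)"
  proof clarify
    fix d and as :: "'a list"
    assume d: "(d, as) \<in> labelled_dyck_paths" "as \<noteq> []"
    obtain p where p: "d = Up # p @ [Down]" "set p \<subseteq> {Up, Down}" "length p = 2 * (length as - 1)"
      using ex[OF d] by blast
    have "motzkin_path (merge_pairs p)"
      using motzkin_path_merge_pairs[of p] d p by (simp add: labelled_dyck_paths_def)
    then show "(merge_pairs (butlast (tl d)), as) \<in> labelled_blue_free_paths"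
      using p d(2) by (simp add: labelled_blue_free_paths_def Blue_notin_merge_pairs length_merge_pairs)
  qed
  show "(\<lambda>(q, as). (Up # split_steps q @ [Down], as)) ` labelled_blue_free_paths \<subseteq>
      {(d, as) \<in> (labelled_dyck_paths :: (_ \<times> 'a list) set). as \<noteq> []}"
  proof clarify
    fix q and as :: "'a list"
    assume q: "(q, as) \<in> labelled_blue_free_paths"
    let ?d = "Up # split_steps q @ [Down]"
    have d: "motzkin_path ?d" "set ?d \<subseteq> {Up, Down}"
      using q set_split_steps[of q]
      by (auto simp: labelled_blue_free_paths_def motzkin_path_merge_pairs merge_split_steps)
    moreover have "count_list ?d Up = Suc (length q)"
      using leads_count_Up[of 0 ?d 0] d by (simp add: motzkin_path_iff_leads)
    ultimately show "(?d, as) \<in> labelled_dyck_paths \<and> as \<noteq> []"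
      using q by (auto simp: labelled_dyck_paths_def labelled_blue_free_paths_def)
  qed
qed

section \<open>Inserting blue steps\<close>

text \<open>The left inverse of the insertion: each label is one more than the number of blue steps
  in its block. Even an empty path has one block, hence a label 1.\<close>

fun block_labels :: "step list \<Rightarrow> nat list" where
  "block_labels [] = [1]"
| "block_labels (s # p) =
     (if s = Horizontal Blue then Suc (hd (block_labels p)) # tl (block_labels p)
      else 1 # block_labels p)"

abbreviation remove_blue :: "step list \<Rightarrow> step list" where
  "remove_blue \<equiv> filter (\<lambda>s. s \<noteq> Horizontal Blue)"

lemma block_labels_neq_Nil [simp]: "block_labels p \<noteq> []"
  by (cases p) auto

lemma block_labels_replicate:
  "block_labels (replicate n (Horizontal Blue) @ p) =
     (n + hd (block_labels p)) # tl (block_labels p)"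
  by (induction n) auto

lemma length_block_labels: "length (block_labels p) = Suc (length (remove_blue p))"
  by (induction p) auto

lemma block_labels_pos: "\<forall>a \<in> set (block_labels p). 1 \<le> a"
  by (induction p) (auto dest: list.set_sel(2)[rotated])

lemma insert_blue_block_labels: "insert_blue (block_labels p) (remove_blue p) = p"
proof (induction p)
  case Nil
  then show ?case by simp
next
  case (Cons s p)
  obtain a as where as: "block_labels p = a # as"
    by (cases "block_labels p") auto
  with block_labels_pos[of p] obtain b where "a = Suc b"
    by (cases a) auto
  with Cons.IH as show ?case
    by (cases "remove_blue p") auto
qed

lemma
  assumes "length as = Suc (length q)" "\<forall>a \<in> set as. 1 \<le> a" "Horizontal Blue \<notin> set q"
  shows block_labels_insert_blue: "block_labels (insert_blue as q) = as"
    and remove_blue_insert_blue: "remove_blue (insert_blue as q) = q"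
  using assms
  by (induction as q rule: insert_blue.induct)
     (auto simp: block_labels_replicate block_labels_replicate[of _ "[]", simplified])

lemma length_insert_blue:
  assumes "length as = Suc (length q)" "\<forall>a \<in> set as. 1 \<le> a"
  shows "Suc (length (insert_blue as q)) = sum_list as"
  using assms by (induction as q rule: insert_blue.induct) auto

lemma leads_replicate_blue [simp]:
  "leads h (replicate n (Horizontal Blue) @ p) k \<longleftrightarrow> leads h p k"
  by (induction n) (auto dest: leads_nonneg)

lemma motzkin_path_insert_blue:
  assumes "length as = Suc (length q)"
  shows "motzkin_path (insert_blue as q) \<longleftrightarrow> motzkin_path q"
proof -
  have "leads h (insert_blue as q) k \<longleftrightarrow> leads h q k" for h k
    using assms leads_replicate_blue[where p = "[]"]
    by (induction as q arbitrary: h rule: insert_blue.induct) auto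
  then show ?thesis
    by (simp add: motzkin_path_iff_leads)
qed

lemma bij_insert_blue:
  "bij_betw (\<lambda>(q, as). insert_blue as q)
     {(q, as) \<in> labelled_blue_free_paths. (\<forall>a \<in> set as. 1 \<le> a) \<and> sum_list as = N}
     {p. motzkin_path p \<and> Suc (length p) = N}"
proof (rule bij_betw_byWitness[where f' = "\<lambda>p. (remove_blue p, block_labels p)"])
  have "motzkin_path (remove_blue p)" if "motzkin_path p" for p
    using that motzkin_path_insert_blue[OF length_block_labels[of p]]
    by (simp add: insert_blue_block_labels)
  moreover have "sum_list (block_labels p) = Suc (length p)" for p
    using length_insert_blue[OF length_block_labels block_labels_pos, of p]
    by (simp add: insert_blue_block_labels)
  ultimately show "(\<lambda>p. (remove_blue p, block_labels p)) ` {p. motzkin_path p \<and> Suc (length p) = N}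
      \<subseteq> {(q, as) \<in> labelled_blue_free_paths. (\<forall>a \<in> set as. 1 \<le> a) \<and> sum_list as = N}"
    using block_labels_pos by (auto simp: labelled_blue_free_paths_def length_block_labels)
qed (auto simp: labelled_blue_free_paths_def block_labels_insert_blue remove_blue_insert_blue
    insert_blue_block_labels motzkin_path_insert_blue length_insert_blue)

section \<open>The bijection\<close>

text \<open>Walking and merging do not touch the labels, so both bijections restrict to the labels
  that are positive and sum to \<open>N\<close>; as \<open>N\<close> is positive, the list of labels is then non-empty,
  and the Dyck path has a first and a last step to delete.\<close>

theorem mainTheorem4:
  fixes N :: nat
  assumes "N \<ge> 1"
  shows "bij_betw Phi
    {t. multi_edge_tree t \<and> num_edges t = N}
    {p. motzkin_path p \<and> length p = N - 1}"
proof -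
  define good where "good as \<longleftrightarrow> (\<forall>a \<in> set as. 1 \<le> a) \<and> sum_list as = N" for as :: "nat list"
  have "\<not> good []"
    using assms by (auto simp: good_def)
  then have ne: "{x \<in> {(d, as) \<in> labelled_dyck_paths. as \<noteq> []}. good (snd x)} =
      {x \<in> labelled_dyck_paths. good (snd x)}"
    by auto
  have walk: "bij_betw (\<lambda>t. (walk t, preorder_labels t))
      {t. multi_edge_tree t \<and> num_edges t = N} {x \<in> labelled_dyck_paths. good (snd x)}"
    using bij_betw_Collect[OF bij_walk, of "\<lambda>x. good (snd x)" "\<lambda>t. good (preorder_labels t)"]
    by (simp add: good_def multi_edge_tree_def num_edges_def)
  have merge: "bij_betw (\<lambda>(d, as). (merge_pairs (butlast (tl d)), as))
      {x \<in> labelled_dyck_paths. good (snd x)} {x \<in> labelled_blue_free_paths. good (snd x)}"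
    using bij_betw_Collect[OF bij_merge_pairs, of "\<lambda>x. good (snd x)" "\<lambda>x. good (snd x)"]
    unfolding ne by auto
  have "bij_betw (\<lambda>(q, as). insert_blue as q)
      {x \<in> labelled_blue_free_paths. good (snd x)} {p. motzkin_path p \<and> Suc (length p) = N}"
    using bij_insert_blue[of N] by (simp add: good_def case_prod_unfold)
  from bij_betw_trans[OF walk bij_betw_trans[OF merge this]]
  have "bij_betw Phi {t. multi_edge_tree t \<and> num_edges t = N} {p. motzkin_path p \<and> Suc (length p) = N}"
    by (simp add: Phi_def comp_def cong: bij_betw_cong)
  moreover have "Suc n = N \<longleftrightarrow> n = N - 1" for n
    using assms by auto
  ultimately show ?thesis
    by simp
qed

end
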